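(* Let an o-minimal structure on the real field $(\mathbb{R},+,\cdot)$ be given; definability is understood in this structure. Let $f: \mathbb{R}^n \to (-\infty, \infty]$ be a proper, lower semi-continuous, definable function and let $\gamma\in \mathbb{R}$ be such that $$S := \{x \in \mathbb{R}^n: f(x) \le \gamma\} \ne \emptyset.$$ Then for any $\bar x \in \mathbb{R}^n$ and $r>0$ there exists a strictly increasing, definable, concave function $\varphi\in C[0, \infty) \cap C^1(0, \infty)$ with $\varphi(0) = 0$ such that $$d(x, S) \le \varphi([f(x) - \gamma]_+)$$ for all $x \in B_r(\bar x)\cap \mathrm{dom}(f)$.
   Context: An o-minimal structure on the real field $(\mathbb{R},+,\cdot)$ is a sequence $\mathcal{O}=(\mathcal{O}_n)_n$ of collections $\mathcal{O}_n$, $n\in\mathbb{N}$, of subsets of $\mathbb{R}^n$ such that: (i) for every $n$, $\mathcal{O}_n$ is closed under finite intersections, finite unions and complements; (ii) if $A\in\mathcal{O}_n$ and $B\in\mathcal{O}_m$ then $A\times B\in\mathcal{O}_{n+m}$; (iii) for any $A\in\mathcal{O}_{n+1}$, $\pi(A)\in\mathcal{O}_n$, where $\pi:\mathbb{R}^{n+1}\to\mathbb{R}^n$ is the canonical projection onto $\mathbb{R}^n$; (iv) $\mathcal{O}_n$ contains every set of the form $\{x\in\mathbb{R}^n: p(x)=0\}$ with $p:\mathbb{R}^n\to\mathbb{R}$ a polynomial; (v) the elements of $\mathcal{O}_1$ are exactly the finite unions of open intervals and points. Sets in $\mathcal{O}_n$ are called definable subsets of $\mathbb{R}^n$. A mapping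 $F:A\subset\mathbb{R}^m\to\mathbb{R}^n$ is definable if its graph $\{(x,y)\in A\times\mathbb{R}^n: y=F(x)\}$ belongs to $\mathcal{O}_{m+n}$; an extended-real-valued function $f$ on a subset of $\mathbb{R}^n$ is definable if its graph $\{(x,t)\in\mathbb{R}^n\times\mathbb{R}: t=f(x)\}$ belongs to $\mathcal{O}_{n+1}$. Notation: $\mathrm{dom}(f):=\{x: f(x)<\infty\}$; $B_r(\bar x)$ is the open ball of radius $r$ centered at $\bar x$; $d(x,S):=\inf_{z\in S}\|x-z\|$; $[t]_+:=\max\{t,0\}$. *)

theory Defs
  imports "HOL-Analysis.Analysis"
begin

text \<open>
  An o-minimal structure involves the spaces \<open>R^n\<close> for all \<open>n\<close> at once, so it is stated over
  lists of length \<open>n\<close>: the product \<open>A \<times> B\<close> becomes concatenation and the canonical projection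
  \<open>R^(n+1) \<rightarrow> R^n\<close> becomes \<^const>\<open>butlast\<close>.
\<close>

definition Rn :: "nat \<Rightarrow> real list set"
  where "Rn n = {x. length x = n}"

text \<open>Polynomial functions \<open>R^n \<rightarrow> R\<close>; compare \<^const>\<open>real_polynomial_function\<close>.\<close>

inductive polynomial_fun :: "nat \<Rightarrow> (real list \<Rightarrow> real) \<Rightarrow> bool" for n
  where
    const: "polynomial_fun n (\<lambda>x. c)"
  | coord: "i < n \<Longrightarrow> polynomial_fun n (\<lambda>x. x ! i)"
  | add: "polynomial_fun n p \<Longrightarrow> polynomial_fun n q \<Longrightarrow> polynomial_fun n (\<lambda>x. p x + q x)"
  | mult: "polynomial_fun n p \<Longrightarrow> polynomial_fun n q \<Longrightarrow> polynomial_fun n (\<lambda>x. p x * q x)"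

text \<open>
  In \<open>one_dim\<close>, the connected open sets of reals are the open intervals, bounded or not.  The index
  \<open>n = 0\<close> is harmless: the axioms force \<open>\<O> 0 = Pow (Rn 0)\<close>.
\<close>

locale o_minimal_structure =
  fixes \<O> :: "nat \<Rightarrow> real list set set"
  assumes subsets: "A \<in> \<O> n \<Longrightarrow> A \<subseteq> Rn n"
    and inter: "A \<in> \<O> n \<Longrightarrow> B \<in> \<O> n \<Longrightarrow> A \<inter> B \<in> \<O> n"
    and union: "A \<in> \<O> n \<Longrightarrow> B \<in> \<O> n \<Longrightarrow> A \<union> B \<in> \<O> n"
    and complement: "A \<in> \<O> n \<Longrightarrow> Rn n - A \<in> \<O> n"
    and product: "A \<in> \<O> n \<Longrightarrow> B \<in> \<O> m \<Longrightarrow> {x @ y |x y. x \<in> A \<and> y \<in> B} \<in> \<O> (n + m)"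
    and projection: "A \<in> \<O> (n + 1) \<Longrightarrow> butlast ` A \<in> \<O> n"
    and algebraic: "polynomial_fun n p \<Longrightarrow> {x \<in> Rn n. p x = 0} \<in> \<O> n"
    and one_dim: "\<O> 1 = {(\<lambda>t. [t]) ` \<Union>\<I> |\<I>. finite \<I> \<and>
                    (\<forall>I\<in>\<I>. (open I \<and> connected I) \<or> (\<exists>a. I = {a}))}"

text \<open>
  The list of coordinates of a vector with respect to a fixed enumeration of the index type.  The
  choice of enumeration is immaterial, as the axioms above make every \<open>\<O> n\<close> invariant under
  permutation of coordinates.
\<close>

definition coords :: "real ^ 'n \<Rightarrow> real list"
  where "coords x = map (\<lambda>i. x $ from_nat_into (UNIV :: 'n set) i) [0..<CARD('n)]"

lemma bij_betw_coords: "bij_betw (coords :: real ^ 'n \<Rightarrow> _) UNIV (Rn CARD('n))"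
proof -
  let ?e = "from_nat_into (UNIV :: 'n set)"
  have e: "bij_betw ?e {..<CARD('n)} UNIV"
    by (rule bij_betw_from_nat_into_finite) simp
  have "inj (coords :: real ^ 'n \<Rightarrow> _)"
  proof (rule injI)
    fix x y :: "real ^ 'n"
    assume "coords x = coords y"
    then have eq: "x $ ?e i = y $ ?e i" if "i < CARD('n)" for i
      using that by (simp add: coords_def)
    show "x = y"
      unfolding vec_eq_iff
    proof
      fix j
      obtain i where "i < CARD('n)" "?e i = j"
        using e by (metis UNIV_I bij_betw_iff_bijections lessThan_iff)
      then show "x $ j = y $ j" using eq by blast
    qed
  qed
  moreover have "range (coords :: real ^ 'n \<Rightarrow> _) = Rn CARD('n)"
  proof (rule set_eqI, rule iffI)
    fix l :: "real list"
    assume "l \<in> range (coords :: real ^ 'n \<Rightarrow> _)"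
    then show "l \<in> Rn CARD('n)" by (auto simp: coords_def Rn_def)
  next
    fix l
    assume l: "l \<in> Rn CARD('n)"
    have "coords (\<chi> j. l ! inv_into {..<CARD('n)} ?e j) = l"
      using l e by (intro nth_equalityI)
        (auto simp: coords_def Rn_def bij_betw_def inv_into_f_f)
    then show "l \<in> range (coords :: real ^ 'n \<Rightarrow> _)" by (metis rangeI)
  qed
  ultimately show ?thesis by (simp add: bij_betw_def)
qed

text \<open>Only finite values contribute to the graph of an extended-real-valued function.\<close>

definition definable_ereal_fun ::
    "(nat \<Rightarrow> real list set set) \<Rightarrow> (real ^ 'n \<Rightarrow> ereal) \<Rightarrow> bool"
  where "definable_ereal_fun \<O> f \<longleftrightarrow>
    {coords x @ [t] |x t. ereal t = f x} \<in> \<O> (CARD('n) + 1)"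

definition definable_real_fun_on ::
    "(nat \<Rightarrow> real list set set) \<Rightarrow> real set \<Rightarrow> (real \<Rightarrow> real) \<Rightarrow> bool"
  where "definable_real_fun_on \<O> A g \<longleftrightarrow> {[s, t] |s t. s \<in> A \<and> t = g s} \<in> \<O> (1 + 1)"

definition edom :: "('a \<Rightarrow> ereal) \<Rightarrow> 'a set"
  where "edom f = {x. f x < \<infinity>}"

definition proper_fun :: "('a \<Rightarrow> ereal) \<Rightarrow> bool"
  where "proper_fun f \<longleftrightarrow> (\<forall>x. f x \<noteq> -\<infinity>) \<and> edom f \<noteq> {}"

definition lower_semicontinuous :: "('a::topological_space \<Rightarrow> ereal) \<Rightarrow> bool"
  where "lower_semicontinuous f \<longleftrightarrow> (\<forall>x. f x \<le> Liminf (at x) f)"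

end

theory Submission
  imports Defs
begin

text \<open>
  Fix the ball \<open>B\<close> of radius \<open>r\<close> around \<open>xbar\<close>.  Call \<open>(K, c)\<close> with \<open>K > 0\<close> and \<open>c \<ge> 0\<close> an affine
  error bound if \<open>d(x, S) \<le> c + K (f x - \<gamma>)\<close> for all \<open>x \<in> B\<close> with \<open>\<gamma> < f x < \<infinity>\<close>, and let \<open>Q\<close> be the
  set of these pairs.  The error function is the infimum of slightly raised affine bounds,
  \<open>\<phi> s = inf {c + 1/K + K s | (K, c) \<in> Q}\<close>.
  All the required properties can be read off this formula:

  \<^item> It dominates the distance, because each of the affine functions does, and it is concave, because
    it is an infimum of affine functions.

  \<^item> It vanishes at \<open>0\<close>, and is continuous there, because \<open>Q\<close> contains pairs with arbitrarily small
    \<open>c + 1/K\<close>.  This is where lower semicontinuity enters (\<open>affine_error_bound\<close>): on the compact part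
    of the closed ball where \<open>d(x, S) \<ge> c\<close>, \<open>f\<close> exceeds \<open>\<gamma>\<close> by a fixed positive amount, so a steep
    enough line lies above the bounded function \<open>d(x, S)\<close>.

  \<^item> It is strictly increasing: \<open>1/K\<close> keeps nearly optimal slopes away from \<open>0\<close>.

  \<^item> It is \<open>C\<^sup>1\<close> on the positive reals, because the term \<open>1/K\<close> makes the minimised function strongly
    convex on bounded sets of slopes.  As \<open>Q\<close> is convex, the midpoint of nearly optimal pairs for
    \<open>s + h\<close> and \<open>s - h\<close> competes at \<open>s\<close>, whence \<open>\<phi> (s + h) + \<phi> (s - h) \<ge> 2 \<phi> s - C h\<^sup>2\<close> (\<open>envelope_semiconvex\<close>).
    A concave function with this property is pinched between a line and a parabola at each point,
    and is therefore \<open>C\<^sup>1\<close> (\<open>concave_semiconvex_imp_C1\<close>).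

  \<^item> It is definable, because \<open>Q\<close> and the graph of \<open>\<phi>\<close> are described by first-order formulas over the
    graph of \<open>f\<close>; definable sets are closed under the logical connectives and quantifiers.
\<close>

section \<open>A smooth concave infimum of affine functions\<close>

lemma concave_supergradient:
  fixes g :: "real \<Rightarrow> real"
  assumes "concave_on {0<..} g" and "0 < s"
  obtains p where "\<And>y. 0 < y \<Longrightarrow> g y \<le> g s + p * (y - s)"
proof -
  let ?q = "Inf ((\<lambda>t. (- g s - (- g t)) / (s - t)) ` ({s<..} \<inter> {0<..}))"
  have "- g y \<ge> - g s + ?q * (y - s)" if "0 < y" for y
    using convex_le_Inf_differential[of "{0<..}" "\<lambda>x. - g x" s y] assms that
    by (simp add: concave_on_def interior_open)
  then have "g y \<le> g s + (- ?q) * (y - s)" if "0 < y" for y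
    using that by fastforce
  then show thesis by (rule that)
qed

text \<open>
  A concave function has a supergradient \<open>p s\<close> at each \<open>s\<close>, so it lies below the line through
  \<open>(s, g s)\<close> of slope \<open>p s\<close>.  Reflecting this bound by the semiconvexity inequality gives the lower
  bound \<open>g s + p s * h - C * h\<^sup>2\<close>, and so the derivative \<open>p s\<close>.  Both bounds at \<open>s\<close>
  and the upper bound at a nearby point together show that \<open>p\<close> is continuous.
\<close>

lemma concave_semiconvex_imp_C1:
  fixes g :: "real \<Rightarrow> real"
  assumes conc: "concave_on {0<..} g"
    and semi: "\<And>a b. 0 < a \<Longrightarrow> \<exists>C\<ge>0. \<forall>s h. a \<le> s - \<bar>h\<bar> \<and> s + \<bar>h\<bar> \<le> b \<longrightarrow>
                  2 * g s - C * h\<^sup>2 \<le> g (s + h) + g (s - h)"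
  shows "g C1_differentiable_on {0<..}"
proof -
  have "\<exists>p. \<forall>y>0. g y \<le> g s + p * (y - s)" if "0 < s" for s
    using concave_supergradient[OF conc that] by metis
  then obtain p where p: "\<And>s y. 0 < s \<Longrightarrow> 0 < y \<Longrightarrow> g y \<le> g s + p s * (y - s)"
    by metis
  have lower: "\<exists>C\<ge>0. \<forall>h. \<bar>h\<bar> \<le> s / 2 \<longrightarrow> g s + p s * h - C * h\<^sup>2 \<le> g (s + h)" if "0 < s" for s
  proof -
    from semi[of "s / 2" "2 * s"] that
    obtain C where C: "C \<ge> 0" "\<And>h. s / 2 \<le> s - \<bar>h\<bar> \<and> s + \<bar>h\<bar> \<le> 2 * s \<Longrightarrow>
        2 * g s - C * h\<^sup>2 \<le> g (s + h) + g (s - h)" by auto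
    have "g s + p s * h - C * h\<^sup>2 \<le> g (s + h)" if h: "\<bar>h\<bar> \<le> s / 2" for h
    proof -
      have "2 * g s - C * h\<^sup>2 \<le> g (s + h) + g (s - h)"
        using h \<open>0 < s\<close> by (intro C(2)) auto
      moreover have "g (s - h) \<le> g s + p s * (s - h - s)"
        using h \<open>0 < s\<close> by (intro p) auto
      ultimately show ?thesis by (simp add: algebra_simps)
    qed
    then show ?thesis using C(1) by blast
  qed
  have deriv: "(g has_real_derivative p s) (at s)" if s: "0 < s" for s
  proof -
    obtain C where C: "C \<ge> 0" "\<And>h. \<bar>h\<bar> \<le> s / 2 \<Longrightarrow> g s + p s * h - C * h\<^sup>2 \<le> g (s + h)"
      using lower[OF s] by blast
    have bound: "\<bar>(g (s + h) - g s) / h - p s\<bar> \<le> C * \<bar>h\<bar>" if h: "\<bar>h\<bar> \<le> s / 2" "h \<noteq> 0" for h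
    proof -
      have "g (s + h) \<le> g s + p s * h"
        using p[of s "s + h"] h s by (simp add: abs_le_iff)
      then have "\<bar>g (s + h) - g s - p s * h\<bar> \<le> C * h\<^sup>2"
        using C(2)[OF h(1)] by (simp add: abs_le_iff)
      moreover have "(g (s + h) - g s) / h - p s = (g (s + h) - g s - p s * h) / h"
        using h by (simp add: field_simps)
      moreover have "C * h\<^sup>2 / \<bar>h\<bar> = C * \<bar>h\<bar>"
        using h by (simp add: field_simps power2_eq_square abs_mult_self_eq flip: abs_mult)
      ultimately show ?thesis
        using h by (metis abs_divide abs_ge_zero divide_right_mono)
    qed
    have "((\<lambda>h. (g (s + h) - g s) / h - p s) \<longlongrightarrow> 0) (at 0)"
    proof (rule Lim_null_comparison)
      show "\<forall>\<^sub>F h in at 0. norm ((g (s + h) - g s) / h - p s) \<le> C * \<bar>h\<bar>"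
        unfolding eventually_at using bound s
        by (intro exI[of _ "s/2"]) (auto simp: dist_real_def)
      show "((\<lambda>h. C * \<bar>h\<bar>) \<longlongrightarrow> 0) (at 0)"
        by (auto intro!: tendsto_eq_intros)
    qed
    then show ?thesis unfolding DERIV_def by (simp add: LIM_zero_iff)
  qed
  have cont: "isCont p s" if s: "0 < s" for s
  proof -
    obtain C where C: "C \<ge> 0" "\<And>h. \<bar>h\<bar> \<le> s / 2 \<Longrightarrow> g s + p s * h - C * h\<^sup>2 \<le> g (s + h)"
      using lower[OF s] by blast
    have bound: "\<bar>p u - p s\<bar> \<le> 4 * C * \<bar>u - s\<bar>" if u: "\<bar>u - s\<bar> \<le> s / 4" for u
    proof (cases "u = s")
      case False
      define h where "h = u - s"
      have us: "u = s + h" by (simp add: h_def)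
      have h: "\<bar>h\<bar> \<le> s / 4" "h \<noteq> 0" using u False by (auto simp: h_def)
      \<comment> \<open>The supergradient at \<open>u = s + h\<close>, tested at \<open>s\<close> and at the mirror point \<open>s + 2 * h\<close>,
        bounds \<open>p u * h\<close> from both sides.\<close>
      have "g (s + 2 * h) \<le> g u + p u * (s + 2 * h - u)"
        using h s by (intro p) (auto simp: us)
      moreover have "g s + p s * (2 * h) - C * (2 * h)\<^sup>2 \<le> g (s + 2 * h)"
        using h by (intro C(2)) auto
      moreover have "g u \<le> g s + p s * h"
        using p[of s u] h s by (auto simp: us)
      moreover have "g s \<le> g u + p u * (s - u)"
        using h s by (intro p) (auto simp: us)
      ultimately have "\<bar>(p u - p s) * h\<bar> \<le> 4 * C * h\<^sup>2"
        by (simp add: us abs_le_iff algebra_simps power2_eq_square)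
      then have "\<bar>p u - p s\<bar> * \<bar>h\<bar> \<le> (4 * C * \<bar>h\<bar>) * \<bar>h\<bar>"
        by (simp add: abs_mult power2_eq_square)
      then show ?thesis using h by (simp add: h_def)
    qed simp
    have "((\<lambda>u. p u - p s) \<longlongrightarrow> 0) (at s)"
    proof (rule Lim_null_comparison)
      show "\<forall>\<^sub>F u in at s. norm (p u - p s) \<le> 4 * C * \<bar>u - s\<bar>"
        unfolding eventually_at using bound s
        by (intro exI[of _ "s/4"]) (auto simp: dist_real_def)
      show "((\<lambda>u. 4 * C * \<bar>u - s\<bar>) \<longlongrightarrow> 0) (at s)"
        by (auto intro!: tendsto_eq_intros)
    qed
    then show ?thesis by (simp add: isCont_def LIM_zero_iff)
  qed
  show ?thesis
    unfolding C1_differentiable_on_def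
    using deriv cont
    by (intro exI[of _ p])
      (auto simp: continuous_at_imp_continuous_on has_real_derivative_iff_has_vector_derivative)
qed

text \<open>
  This is the strong convexity of \<open>1/x\<close> on \<open>(0, B]\<close>, with the quadratic gain traded against the
  perturbation \<open>(x - y) * h\<close>: the difference of both sides is at least the square
  \<open>(x - y + B^3 h)\<^sup>2 / (2 B^3)\<close>.
\<close>

lemma inverse_midpoint_gap:
  fixes x y B h :: real
  assumes "0 < x" "0 < y" "x \<le> B" "y \<le> B"
  shows "4 / (x + y) - B ^ 3 * h\<^sup>2 / 2 \<le> 1 / x + 1 / y + (x - y) * h"
proof -
  have B: "0 < B ^ 3" using assms by simp
  have "x * y * (x + y) \<le> B * B * (B + B)"
    using assms by (intro mult_mono add_mono) auto
  also have "\<dots> = 2 * B ^ 3" by (simp add: power3_eq_cube)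
  finally have "(x - y)\<^sup>2 / (2 * B ^ 3) \<le> (x - y)\<^sup>2 / (x * y * (x + y))"
    using assms by (intro divide_left_mono) auto
  also have "\<dots> = 1 / x + 1 / y - 4 / (x + y)"
  proof -
    have "x \<noteq> 0" "y \<noteq> 0" "x + y \<noteq> 0" using assms by auto
    then show ?thesis by (simp add: divide_simps) (simp add: algebra_simps power2_eq_square)
  qed
  finally have "(x - y)\<^sup>2 / (2 * B ^ 3) \<le> 1 / x + 1 / y - 4 / (x + y)" .
  moreover have "0 \<le> (x - y + B ^ 3 * h)\<^sup>2 / (2 * B ^ 3)" using B by simp
  moreover have "(x - y + B ^ 3 * h)\<^sup>2 / (2 * B ^ 3)
      = (x - y)\<^sup>2 / (2 * B ^ 3) + (x - y) * h + B ^ 3 * h\<^sup>2 / 2"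
  proof -
    have "(d + M * h)\<^sup>2 / (2 * M) = d\<^sup>2 / (2 * M) + d * h + M * h\<^sup>2 / 2" if "M \<noteq> 0" for d M :: real
      using that by (simp add: field_simps power2_eq_square)
    then show ?thesis using B by simp
  qed
  ultimately show ?thesis by linarith
qed

text \<open>
  A pair \<open>(K, c)\<close> stands for the affine function of slope \<open>K\<close> and value \<open>c\<close> at \<open>0\<close>.
\<close>

locale affine_majorants =
  fixes Q :: "(real \<times> real) set"
  assumes convex_Q: "convex Q"
    and slope_pos: "(K, c) \<in> Q \<Longrightarrow> 0 < K"
    and const_nonneg: "(K, c) \<in> Q \<Longrightarrow> 0 \<le> c"
    and small_at_0: "0 < e \<Longrightarrow> \<exists>K c. (K, c) \<in> Q \<and> c + 1 / K < e"
begin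

text \<open>
  Up to sign this is a convex conjugate; the term \<open>1 / K\<close> is the regularisation that makes it
  differentiable and strictly increasing.
\<close>

definition envelope :: "real \<Rightarrow> real"
  where "envelope s = (INF (K, c)\<in>Q. c + 1 / K + K * s)"

lemma envelope_le:
  assumes "(K, c) \<in> Q" "0 \<le> s"
  shows "envelope s \<le> c + 1 / K + K * s"
proof -
  have "bdd_below ((\<lambda>(K, c). c + 1 / K + K * s) ` Q)"
  proof (rule bdd_belowI2[where m = 0])
    fix q assume "q \<in> Q"
    then show "0 \<le> (case q of (K, c) \<Rightarrow> c + 1 / K + K * s)"
      using slope_pos const_nonneg assms(2) by (cases q) (auto simp: less_imp_le)
  qed
  from cINF_lower[OF this assms(1)] show ?thesis by (simp add: envelope_def)
qed

lemma envelope_greatest: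
  assumes "\<And>K c. (K, c) \<in> Q \<Longrightarrow> y \<le> c + 1 / K + K * s"
  shows "y \<le> envelope s"
proof -
  have "Q \<noteq> {}" using small_at_0[of 1] by auto
  then show ?thesis
    unfolding envelope_def using assms by (intro cINF_greatest) auto
qed

lemma envelope_approx:
  assumes "0 < e"
  obtains K c where "(K, c) \<in> Q" "c + 1 / K + K * s < envelope s + e"
proof -
  have "\<not> envelope s + e \<le> envelope s" using assms by simp
  then show thesis
    using envelope_greatest[of "envelope s + e" s] that by (meson not_le)
qed

lemma envelope_nonneg: "0 \<le> s \<Longrightarrow> 0 \<le> envelope s"
  using slope_pos const_nonneg by (intro envelope_greatest) (auto simp: less_imp_le)

lemma envelope_0: "envelope 0 = 0"
proof -
  have "envelope 0 \<le> e" if "0 < e" for e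
    using small_at_0[OF that] envelope_le[of _ _ 0] by fastforce
  then have "envelope 0 \<le> 0" by (meson dense not_le)
  then show ?thesis using envelope_nonneg[of 0] by simp
qed

lemma envelope_strict_mono: "strict_mono_on {0..} envelope"
proof (rule strict_mono_onI)
  fix a b :: real assume "a \<in> {0..}" "b \<in> {0..}" and ab: "a < b"
  then have a: "0 \<le> a" and b: "0 \<le> b" by auto
  \<comment> \<open>A lower bound for the slope of all pairs that are optimal at \<open>b\<close> up to an error of \<open>1\<close>.\<close>
  define k where "k = 1 / (envelope b + 1)"
  have k: "0 < k" using envelope_nonneg[OF b] by (simp add: k_def)
  define e where "e = min 1 (k * (b - a))"
  have e: "0 < e" "e \<le> 1" "e \<le> k * (b - a)" using k ab by (auto simp: e_def)
  obtain K c where Kc: "(K, c) \<in> Q" "c + 1 / K + K * b < envelope b + e"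
    using envelope_approx[OF e(1)] .
  note pos = slope_pos[OF Kc(1)] const_nonneg[OF Kc(1)]
  have "0 \<le> K * b" using pos b by simp
  then have "1 / K \<le> envelope b + 1" using Kc(2) pos e by linarith
  then have "k \<le> K"
    using pos envelope_nonneg[OF b] by (simp add: k_def field_simps)
  then have "k * (b - a) \<le> K * (b - a)" using ab by (intro mult_right_mono) auto
  moreover have "envelope a \<le> c + 1 / K + K * a" by (rule envelope_le[OF Kc(1) a])
  ultimately show "envelope a < envelope b"
    using Kc(2) e by (simp add: algebra_simps)
qed

lemma envelope_mono: "0 \<le> a \<Longrightarrow> a \<le> b \<Longrightarrow> envelope a \<le> envelope b"
  using envelope_strict_mono by (simp add: strict_mono_on_leD)

lemma envelope_concave: "concave_on {0..} envelope"
  unfolding concave_on_iff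
proof (intro conjI ballI allI impI)
  fix x y u v :: real
  assume xy: "x \<in> {0..}" "y \<in> {0..}" and uv: "0 \<le> u" "0 \<le> v" "u + v = 1"
  show "u * envelope x + v * envelope y \<le> envelope (u *\<^sub>R x + v *\<^sub>R y)"
  proof (rule envelope_greatest)
    fix K c assume Kc: "(K, c) \<in> Q"
    have "u * envelope x + v * envelope y
        \<le> u * (c + 1 / K + K * x) + v * (c + 1 / K + K * y)"
      using uv xy by (intro add_mono mult_left_mono envelope_le[OF Kc]) auto
    also have "\<dots> = (u + v) * (c + 1 / K) + K * (u * x + v * y)"
      by (simp only: distrib_left distrib_right mult_ac add_ac)
    also have "\<dots> = c + 1 / K + K * (u *\<^sub>R x + v *\<^sub>R y)" by (simp add: uv)
    finally show "u * envelope x + v * envelope y \<le> c + 1 / K + K * (u *\<^sub>R x + v *\<^sub>R y)" .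
  qed
qed simp

text \<open>
  Nearly optimal pairs \<open>(K, c)\<close> for \<open>s + h\<close> and \<open>(L, d)\<close> for \<open>s - h\<close> have slopes at most
  \<open>B = (envelope b + 1) / a\<close>.  Their midpoint is in \<open>Q\<close> and bounds \<open>envelope s\<close>; what is lost in
  passing to the midpoint is controlled by the strong convexity of the reciprocal.
\<close>

lemma envelope_semiconvex:
  assumes a: "0 < a" and ah: "a \<le> s - \<bar>h\<bar>" and hb: "s + \<bar>h\<bar> \<le> b"
  shows "2 * envelope s - ((envelope b + 1) / a) ^ 3 / 2 * h\<^sup>2
           \<le> envelope (s + h) + envelope (s - h)"
proof -
  define B where "B = (envelope b + 1) / a"
  have "2 * envelope s - B ^ 3 / 2 * h\<^sup>2 \<le> envelope (s + h) + envelope (s - h) + e"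
    if e: "0 < e" for e
  proof -
    define e' where "e' = min 1 (e / 2)"
    have e': "0 < e'" "e' \<le> 1" "e' \<le> e / 2" using e by (auto simp: e'_def)
    obtain K c where 1: "(K, c) \<in> Q" "c + 1 / K + K * (s + h) < envelope (s + h) + e'"
      using envelope_approx[OF e'(1)] .
    obtain L d where 2: "(L, d) \<in> Q" "d + 1 / L + L * (s - h) < envelope (s - h) + e'"
      using envelope_approx[OF e'(1)] .
    have slope_le: "K \<le> B"
      if "(K, c) \<in> Q" "c + 1 / K + K * t < envelope t + e'" "a \<le> t" "t \<le> b" for K c t
    proof -
      note pos = slope_pos[OF that(1)] const_nonneg[OF that(1)]
      have "0 < 1 / K" using pos by simp
      moreover have "K * a \<le> K * t" using pos that by simp
      moreover have "envelope t \<le> envelope b" using that a by (intro envelope_mono) auto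
      ultimately have "K * a \<le> envelope b + 1" using that(2) pos e' by linarith
      then show ?thesis using a by (simp add: B_def field_simps)
    qed
    have KB: "K \<le> B" using 1 ah hb by (intro slope_le[of K c "s + h"]) auto
    have LB: "L \<le> B" using 2 ah hb by (intro slope_le[of L d "s - h"]) auto
    have mid: "((K + L) / 2, (c + d) / 2) \<in> Q"
      using convexD[OF convex_Q 1(1) 2(1), of "1/2" "1/2"] by (simp add: add_divide_distrib)
    have "envelope s \<le> (c + d) / 2 + 1 / ((K + L) / 2) + (K + L) / 2 * s"
      using a ah by (intro envelope_le[OF mid]) auto
    then have "2 * envelope s \<le> c + d + 4 / (K + L) + (K + L) * s"
      by (simp add: field_simps)
    also have "4 / (K + L) \<le> 1 / K + 1 / L + (K - L) * h + B ^ 3 / 2 * h\<^sup>2"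
      using inverse_midpoint_gap[OF slope_pos[OF 1(1)] slope_pos[OF 2(1)] KB LB, of h] by simp
    finally show ?thesis using 1(2) 2(2) e' by (simp add: algebra_simps)
  qed
  then show ?thesis unfolding B_def by (rule field_le_epsilon)
qed

lemma envelope_C1: "envelope C1_differentiable_on {0<..}"
proof (rule concave_semiconvex_imp_C1)
  show "concave_on {0<..} envelope"
    using envelope_concave unfolding concave_on_def
    by (rule convex_on_subset) auto
  fix a b :: real assume a: "0 < a"
  show "\<exists>C\<ge>0. \<forall>s h. a \<le> s - \<bar>h\<bar> \<and> s + \<bar>h\<bar> \<le> b \<longrightarrow>
          2 * envelope s - C * h\<^sup>2 \<le> envelope (s + h) + envelope (s - h)"
  proof (cases "0 \<le> b")
    case True
    then show ?thesis
      using envelope_semiconvex[OF a] envelope_nonneg[OF True] a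
      by (intro exI[of _ "((envelope b + 1) / a) ^ 3 / 2"]) auto
  next
    case False
    then show ?thesis using a by (intro exI[of _ 0]) auto
  qed
qed

lemma envelope_continuous: "continuous_on {0..} envelope"
proof -
  have "continuous (at s within {0..}) envelope" if "0 \<le> s" for s
  proof (cases "s = 0")
    case False
    then have "envelope differentiable at s"
      using envelope_C1 that by (simp add: C1_differentiable_on_eq)
    then show ?thesis
      by (simp add: continuous_at_imp_continuous_at_within differentiable_imp_continuous_within)
  next
    case True
    have "(envelope \<longlongrightarrow> 0) (at 0 within {0..})"
    proof (rule order_tendstoI)
      fix y :: real assume "y < 0"
      then show "\<forall>\<^sub>F s in at 0 within {0..}. y < envelope s"
        unfolding eventually_at_filter
        by (intro always_eventually) (auto intro: less_le_trans[OF _ envelope_nonneg])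
    next
      fix y :: real assume "0 < y"
      then obtain K c where Kc: "(K, c) \<in> Q" "c + 1 / K < y" using small_at_0 by blast
      have "((\<lambda>s. c + 1 / K + K * s) \<longlongrightarrow> c + 1 / K + K * 0) (at 0 within {0..})"
        by (intro tendsto_intros)
      then have "\<forall>\<^sub>F s in at 0 within {0..}. c + 1 / K + K * s < y"
        by (rule order_tendstoD) (use Kc in simp)
      moreover have "\<forall>\<^sub>F s in at (0::real) within {0..}. 0 \<le> s"
        by (simp add: eventually_at_filter)
      ultimately show "\<forall>\<^sub>F s in at 0 within {0..}. envelope s < y"
        by eventually_elim (use envelope_le[OF Kc(1)] in fastforce)
    qed
    then show ?thesis using True by (simp add: continuous_within envelope_0)
  qed
  then show ?thesis by (simp add: continuous_on_eq_continuous_within)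
qed

text \<open>
  The infimum as a first-order condition, multiplied by \<open>K\<close> so that only polynomials occur.
\<close>

lemma envelope_eq_iff:
  assumes s: "0 \<le> s"
  shows "y = envelope s \<longleftrightarrow>
    (\<forall>K c. (K, c) \<in> Q \<longrightarrow> y * K \<le> c * K + 1 + K * K * s) \<and>
    (\<forall>e>0. \<exists>K c. (K, c) \<in> Q \<and> c * K + 1 + K * K * s < (y + e) * K)" (is "_ \<longleftrightarrow> ?R")
proof -
  have clear: "z * K \<le> c * K + 1 + K * K * s \<longleftrightarrow> z \<le> c + 1 / K + K * s" if "(K, c) \<in> Q" for K c z
    using slope_pos[OF that] by (simp add: field_simps)
  have "?R \<longleftrightarrow> (\<forall>K c. (K, c) \<in> Q \<longrightarrow> y \<le> c + 1 / K + K * s) \<and>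
      (\<forall>e>0. \<exists>K c. (K, c) \<in> Q \<and> c + 1 / K + K * s < y + e)" (is "_ \<longleftrightarrow> ?L1 \<and> ?L2")
    using clear by (meson not_le)
  also have "?L1 \<longleftrightarrow> y \<le> envelope s"
    using envelope_le[OF _ s] envelope_greatest by (meson order_trans)
  also have "?L2 \<longleftrightarrow> envelope s \<le> y"
  proof
    assume ?L2
    then have "envelope s \<le> y + e" if "0 < e" for e
      using that envelope_le[OF _ s] by (meson less_imp_le order_trans)
    then show "envelope s \<le> y" by (rule field_le_epsilon)
  next
    assume le: "envelope s \<le> y"
    show ?L2
    proof (intro allI impI)
      fix e :: real assume "0 < e"
      then obtain K c where "(K, c) \<in> Q" "c + 1 / K + K * s < envelope s + e"
        using envelope_approx by blast
      then show "\<exists>K c. (K, c) \<in> Q \<and> c + 1 / K + K * s < y + e" using le by force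
    qed
  qed
  finally show ?thesis by auto
qed

end

section \<open>Definability of first-order conditions\<close>

lemma polynomial_fun_diff:
  assumes "polynomial_fun n p" "polynomial_fun n q"
  shows "polynomial_fun n (\<lambda>x. p x - q x)"
  using polynomial_fun.add[OF assms(1) polynomial_fun.mult[OF polynomial_fun.const[of n "-1"] assms(2)]]
  by simp

lemma polynomial_fun_power2: "polynomial_fun n p \<Longrightarrow> polynomial_fun n (\<lambda>x. (p x)\<^sup>2)"
  unfolding power2_eq_square by (rule polynomial_fun.mult)

lemma polynomial_fun_sum:
  "(\<And>i. i < m \<Longrightarrow> polynomial_fun n (p i)) \<Longrightarrow> polynomial_fun n (\<lambda>x. \<Sum>i<(m::nat). p i x)"
  by (induction m) (auto intro: polynomial_fun.intros)

lemmas polynomial_intros =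
  polynomial_fun.intros polynomial_fun_diff polynomial_fun_power2 polynomial_fun_sum

text \<open>For polynomial conditions under quantifiers, which append variables to the list.\<close>

lemma polynomial_fun_append:
  "polynomial_fun n p \<Longrightarrow> polynomial_fun (n + k) p \<and> (\<forall>v\<in>Rn n. p (v @ w) = p v)"
  by (induction rule: polynomial_fun.induct)
    (auto intro: polynomial_fun.intros simp: Rn_def nth_append)

context o_minimal_structure
begin

text \<open>
  Instead of sets of lists, the closure properties are stated for predicates on lists; they then act
  as introduction rules that follow the structure of a formula, with list positions as variables.
\<close>

definition definable_pred :: "nat \<Rightarrow> (real list \<Rightarrow> bool) \<Rightarrow> bool"
  where "definable_pred n P \<longleftrightarrow> {v \<in> Rn n. P v} \<in> \<O> n"

lemma definable_cong:
  "definable_pred n P \<Longrightarrow> (\<And>v. v \<in> Rn n \<Longrightarrow> P v = P' v) \<Longrightarrow> definable_pred n P'"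
  unfolding definable_pred_def by (metis (mono_tags, lifting) Collect_cong)

lemma definable_conj:
  "definable_pred n P \<Longrightarrow> definable_pred n P' \<Longrightarrow> definable_pred n (\<lambda>v. P v \<and> P' v)"
  using inter[of "{v \<in> Rn n. P v}" n "{v \<in> Rn n. P' v}"]
  by (auto simp: definable_pred_def Collect_conj_eq Int_ac)

lemma definable_not: "definable_pred n P \<Longrightarrow> definable_pred n (\<lambda>v. \<not> P v)"
  using complement[of "{v \<in> Rn n. P v}" n]
  by (auto simp: definable_pred_def set_diff_eq conj_disj_distribL elim: back_subst[of "\<lambda>A. A \<in> \<O> n"])

lemma definable_imp:
  "definable_pred n P \<Longrightarrow> definable_pred n P' \<Longrightarrow> definable_pred n (\<lambda>v. P v \<longrightarrow> P' v)"
  using definable_not[OF definable_conj[OF _ definable_not]] by simp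

lemma definable_ex1:
  assumes "definable_pred (n + 1) P"
  shows "definable_pred n (\<lambda>v. \<exists>t. P (v @ [t]))"
proof -
  have "{v \<in> Rn n. \<exists>t. P (v @ [t])} = butlast ` {w \<in> Rn (n + 1). P w}"
  proof (intro set_eqI iffI)
    fix v assume "v \<in> {v \<in> Rn n. \<exists>t. P (v @ [t])}"
    then obtain t where "v \<in> Rn n" "P (v @ [t])" by auto
    then show "v \<in> butlast ` {w \<in> Rn (n + 1). P w}"
      by (intro image_eqI[of _ _ "v @ [t]"]) (auto simp: Rn_def)
  next
    fix v assume "v \<in> butlast ` {w \<in> Rn (n + 1). P w}"
    then obtain w where w: "length w = n + 1" "P w" "v = butlast w" by (auto simp: Rn_def)
    then have "v @ [last w] = w" by (auto intro: append_butlast_last_id)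
    then have "P (v @ [last w])" using w(2) by simp
    then show "v \<in> {v \<in> Rn n. \<exists>t. P (v @ [t])}" using w by (auto simp: Rn_def)
  qed
  then show ?thesis
    using projection assms unfolding definable_pred_def by presburger
qed

text \<open>
  A quantifier over points of \<open>R^k\<close> is a sequence of \<open>k\<close> projections.  The second hypothesis lets
  the matrix of the formula be given with the bound point as a separate argument.
\<close>

lemma definable_ex:
  assumes "definable_pred (n + k) P"
    and "\<And>v w. v \<in> Rn n \<Longrightarrow> w \<in> Rn k \<Longrightarrow> P (v @ w) \<longleftrightarrow> P' v w"
  shows "definable_pred n (\<lambda>v. \<exists>w\<in>Rn k. P' v w)"
proof -
  have "definable_pred (n + k) P \<Longrightarrow> definable_pred n (\<lambda>v. \<exists>w\<in>Rn k. P (v @ w))"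
  proof (induction k arbitrary: P)
    case 0
    then show ?case by (simp add: Rn_def)
  next
    case (Suc k)
    have "definable_pred (n + k) (\<lambda>v. \<exists>t. P (v @ [t]))"
      using Suc.prems by (intro definable_ex1) simp
    from Suc.IH[OF this] have "definable_pred n (\<lambda>v. \<exists>w\<in>Rn k. \<exists>t. P ((v @ w) @ [t]))" .
    then show ?case
    proof (rule definable_cong)
      fix v
      show "(\<exists>w\<in>Rn k. \<exists>t. P ((v @ w) @ [t])) \<longleftrightarrow> (\<exists>w\<in>Rn (Suc k). P (v @ w))"
        by (auto simp: Rn_def length_Suc_conv_rev)
    qed
  qed
  from definable_cong[OF this[OF assms(1)]] show ?thesis using assms(2) by auto
qed

lemma definable_all:
  assumes "definable_pred (n + k) P"
    and "\<And>v w. v \<in> Rn n \<Longrightarrow> w \<in> Rn k \<Longrightarrow> P (v @ w) \<longleftrightarrow> P' v w"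
  shows "definable_pred n (\<lambda>v. \<forall>w\<in>Rn k. P' v w)"
  using definable_not[OF definable_ex[OF definable_not[OF assms(1)], of "\<lambda>v w. \<not> P' v w"]] assms(2)
  by simp

lemma definable_poly_eq:
  assumes "polynomial_fun n p" "polynomial_fun n q"
  shows "definable_pred n (\<lambda>v. p v = q v)"
  using algebraic[OF polynomial_fun_diff[OF assms]] by (simp add: definable_pred_def)

text \<open>The order is definable from the field operations: a real is nonnegative iff it is a square.\<close>

lemma definable_poly_le:
  assumes p: "polynomial_fun n p" and q: "polynomial_fun n q"
  shows "definable_pred n (\<lambda>v. p v \<le> q v)"
proof -
  let ?d = "\<lambda>v. q v - p v"
  have d: "polynomial_fun n ?d" by (rule polynomial_fun_diff[OF q p])
  have "polynomial_fun (n + 1) ?d"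
    using polynomial_fun_append[OF d, of 1] by blast
  then have "definable_pred (n + 1) (\<lambda>w. (w ! n)\<^sup>2 = ?d w)"
    by (intro definable_poly_eq polynomial_fun_power2 polynomial_fun.coord) simp_all
  from definable_ex1[OF this] show ?thesis
  proof (rule definable_cong)
    fix v assume v: "v \<in> Rn n"
    have "(\<exists>t. ((v @ [t]) ! n)\<^sup>2 = ?d (v @ [t])) \<longleftrightarrow> (\<exists>t. t\<^sup>2 = ?d v)"
      using v polynomial_fun_append[OF d, of 1] by (auto simp: Rn_def)
    also have "\<dots> \<longleftrightarrow> 0 \<le> ?d v"
      by (metis real_sqrt_pow2 zero_le_power2)
    finally show "(\<exists>t. ((v @ [t]) ! n)\<^sup>2 = ?d (v @ [t])) \<longleftrightarrow> p v \<le> q v" by simp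
  qed
qed

lemma definable_poly_less:
  "polynomial_fun n p \<Longrightarrow> polynomial_fun n q \<Longrightarrow> definable_pred n (\<lambda>v. p v < q v)"
  using definable_not[OF definable_poly_le[of n q p]] by (simp add: not_le)

lemma Rn_definable: "Rn n \<in> \<O> n"
  using algebraic[OF polynomial_fun.const[of n 0]] by simp

text \<open>
  Membership of a contiguous block of coordinates in a definable set is a product with full spaces.
  In the formulas below the variables are ordered so that graphs occur in this form only.
\<close>

lemma definable_block:
  assumes A: "A \<in> \<O> k" and ik: "i + k \<le> n"
  shows "definable_pred n (\<lambda>v. take k (drop i v) \<in> A)"
proof -
  let ?B = "{x @ y |x y. x \<in> {x @ y |x y. x \<in> Rn i \<and> y \<in> A} \<and> y \<in> Rn (n - i - k)}"
  have "?B \<in> \<O> (i + k + (n - i - k))"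
    by (intro product Rn_definable A)
  moreover have "?B = {v \<in> Rn n. take k (drop i v) \<in> A}"
  proof (intro set_eqI iffI)
    fix v assume "v \<in> ?B"
    then obtain x y z where "v = (x @ y) @ z" "x \<in> Rn i" "y \<in> A" "z \<in> Rn (n - i - k)" by blast
    then show "v \<in> {v \<in> Rn n. take k (drop i v) \<in> A}"
      using subsets[OF A] ik by (auto simp: Rn_def)
  next
    fix v assume v: "v \<in> {v \<in> Rn n. take k (drop i v) \<in> A}"
    have "v = (take i v @ take k (drop i v)) @ drop k (drop i v)"
      by (simp only: append_assoc append_take_drop_id)
    moreover have "take i v \<in> Rn i" "drop k (drop i v) \<in> Rn (n - i - k)"
      using v ik by (auto simp: Rn_def)
    ultimately show "v \<in> ?B" using v by blast
  qed
  ultimately show ?thesis using ik by (simp add: definable_pred_def)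
qed

lemma envelope_definable:
  assumes "affine_majorants Q"
    and Q: "{[K, c] |K c. (K, c) \<in> Q} \<in> \<O> 2" (is "?Q \<in> _")
  shows "definable_real_fun_on \<O> {0..} (affine_majorants.envelope Q)"
proof -
  interpret affine_majorants Q by fact
  have Rn2: "w \<in> Rn 2 \<longleftrightarrow> (\<exists>K c. w = [K, c])" for w
    by (auto simp: Rn_def numeral_2_eq_2 length_Suc_conv)
  have mem: "[K, c] \<in> ?Q \<longleftrightarrow> (K, c) \<in> Q" for K c by simp
  \<comment> \<open>Here \<open>v\<close> is \<open>[s, y]\<close> (followed by the error \<open>e\<close> in \<open>T\<close>) and \<open>w\<close> is \<open>[K, c]\<close>; \<open>R\<close> and \<open>T\<close> are
    the matrices of the two parts of the first-order description of the graph.\<close>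
  define R where "R v w \<longleftrightarrow> (w \<in> ?Q \<longrightarrow> v ! 1 * w ! 0 \<le> w ! 1 * w ! 0 + 1 + w ! 0 * w ! 0 * v ! 0)" for v w :: "real list"
  define T where "T v w \<longleftrightarrow> (w \<in> ?Q \<and> w ! 1 * w ! 0 + 1 + w ! 0 * w ! 0 * v ! 0 < (v ! 1 + v ! 2) * w ! 0)"
    for v w :: "real list"
  have 1: "definable_pred 2 (\<lambda>v. \<forall>w\<in>Rn 2. R v w)"
  proof (rule definable_all)
    show "definable_pred (2 + 2) (\<lambda>v. take 2 (drop 2 v) \<in> ?Q \<longrightarrow>
        v ! 1 * v ! 2 \<le> v ! 3 * v ! 2 + 1 + v ! 2 * v ! 2 * v ! 0)"
      by (intro definable_imp definable_block Q definable_poly_le polynomial_intros) auto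
  qed (auto simp: R_def Rn_def nth_append)
  have "definable_pred 3 (\<lambda>v. \<exists>w\<in>Rn 2. T v w)"
  proof (rule definable_ex)
    show "definable_pred (3 + 2) (\<lambda>v. take 2 (drop 3 v) \<in> ?Q \<and>
        v ! 4 * v ! 3 + 1 + v ! 3 * v ! 3 * v ! 0 < (v ! 1 + v ! 2) * v ! 3)"
      by (intro definable_conj definable_block Q definable_poly_less polynomial_intros) auto
  qed (auto simp: T_def Rn_def nth_append)
  then have "definable_pred (2 + 1) (\<lambda>v. 0 < v ! 2 \<longrightarrow> (\<exists>w\<in>Rn 2. T v w))"
    by (intro definable_imp definable_poly_less polynomial_intros) auto
  then have 2: "definable_pred 2 (\<lambda>v. \<forall>u\<in>Rn 1. 0 < (v @ u) ! 2 \<longrightarrow> (\<exists>w\<in>Rn 2. T (v @ u) w))"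
    by (rule definable_all) simp
  have 3: "definable_pred 2 (\<lambda>v. 0 \<le> v ! 0)"
    by (intro definable_poly_le polynomial_intros) auto
  have eq: "{v \<in> Rn 2. 0 \<le> v ! 0 \<and> (\<forall>w\<in>Rn 2. R v w) \<and>
          (\<forall>u\<in>Rn 1. 0 < (v @ u) ! 2 \<longrightarrow> (\<exists>w\<in>Rn 2. T (v @ u) w))}
      = {[s, t] |s t. s \<in> {0..} \<and> t = envelope s}"
  proof -
    have "(\<forall>w\<in>Rn 2. R [s, y] w) \<and>
          (\<forall>u\<in>Rn 1. 0 < ([s, y] @ u) ! 2 \<longrightarrow> (\<exists>w\<in>Rn 2. T ([s, y] @ u) w))
          \<longleftrightarrow> y = envelope s" if "0 \<le> s" for s y
    proof -
      have allRn2: "(\<forall>w\<in>Rn 2. P w) \<longleftrightarrow> (\<forall>K c. P [K, c])"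
        and exRn2: "(\<exists>w\<in>Rn 2. P w) \<longleftrightarrow> (\<exists>K c. P [K, c])" for P
        unfolding Ball_def Bex_def Rn2 by metis+
      have Rn1: "(\<forall>u\<in>Rn 1. P u) \<longleftrightarrow> (\<forall>e. P [e])" for P
        by (auto simp: Rn_def length_Suc_conv)
      show ?thesis
        unfolding envelope_eq_iff[OF that] Rn1 allRn2 exRn2
        by (simp add: R_def T_def numeral_2_eq_2)
    qed
    then have "v \<in> Rn 2 \<and> 0 \<le> v ! 0 \<and> (\<forall>w\<in>Rn 2. R v w) \<and>
          (\<forall>u\<in>Rn 1. 0 < (v @ u) ! 2 \<longrightarrow> (\<exists>w\<in>Rn 2. T (v @ u) w))
        \<longleftrightarrow> (\<exists>s t. v = [s, t] \<and> s \<in> {0..} \<and> t = envelope s)" for v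
      unfolding Rn2[of v] by (metis atLeast_iff nth_Cons_0)
    then show ?thesis by blast
  qed
  show ?thesis
    using definable_conj[OF 3 definable_conj[OF 1 2]] eq
    by (simp add: definable_real_fun_on_def definable_pred_def numeral_2_eq_2)
qed

end

section \<open>Lower semicontinuity and the sublevel set\<close>

lemma lower_semicontinuous_open:
  assumes "lower_semicontinuous f"
  shows "open {x. (a::ereal) < f x}"
proof -
  have "\<forall>\<^sub>F y in nhds x. a < f y" if "a < f x" for x
  proof -
    have "a < Liminf (at x) f"
      using assms that by (auto simp: lower_semicontinuous_def intro: less_le_trans)
    then show ?thesis using less_LiminfD that by (simp add: eventually_nhds_conv_at)
  qed
  then show ?thesis by (subst open_subopen) (fastforce simp: eventually_nhds)
qed

text \<open>
  The points of the closed ball at distance at least \<open>e\<close> from \<open>S\<close> form a compact set, covered by the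
  open sets \<open>{x. \<gamma> + 1 / (m + 1) < f x}\<close>.  So \<open>f\<close> exceeds \<open>\<gamma>\<close> there by a fixed amount, and the
  distance to \<open>S\<close> is bounded on the ball.
\<close>

lemma affine_error_bound:
  fixes f :: "'a::{heine_borel, real_normed_vector} \<Rightarrow> ereal"
  assumes lsc: "lower_semicontinuous f" and S: "S = {x. f x \<le> ereal \<gamma>}" "S \<noteq> {}" and e: "0 < e"
  obtains K where "0 < K"
    "\<And>x t. x \<in> ball xbar r \<Longrightarrow> f x = ereal t \<Longrightarrow> \<gamma> < t \<Longrightarrow> infdist x S \<le> e + K * (t - \<gamma>)"
proof -
  obtain z where z: "z \<in> S" using S by blast
  have "compact (cball xbar r \<inter> {x. e \<le> infdist x S})" (is "compact ?C")
    by (intro compact_Int_closed compact_cball closed_Collect_le continuous_intros)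
  moreover have "?C \<subseteq> (\<Union>m. {x. ereal (\<gamma> + 1 / Suc m) < f x})"
  proof
    fix x assume x: "x \<in> ?C"
    then have "x \<notin> S" using e by auto
    then have gt: "ereal \<gamma> < f x" using S by auto
    then obtain b where b: "ereal \<gamma> < ereal b" "ereal b < f x"
      by (metis ereal_dense2 )
    then obtain m where "inverse (real (Suc m)) < b - \<gamma>"
      using reals_Archimedean[of "b - \<gamma>"] by auto
    then have "ereal (\<gamma> + 1 / Suc m) < ereal b" by (simp add: field_simps)
    then show "x \<in> (\<Union>m. {x. ereal (\<gamma> + 1 / Suc m) < f x})"
      using b(2) less_trans by blast
  qed
  ultimately obtain D where D: "finite D" "?C \<subseteq> (\<Union>m\<in>D. {x. ereal (\<gamma> + 1 / Suc m) < f x})"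
    using lower_semicontinuous_open[OF lsc] by (elim compactE_image[where f = "\<lambda>m. {x. ereal (\<gamma> + 1 / Suc m) < f x}" and C = UNIV]) blast+
  obtain N where N: "\<And>m. m \<in> D \<Longrightarrow> m \<le> N"
    using D(1) finite_nat_set_iff_bounded_le by auto
  define B where "B = dist xbar z + \<bar>r\<bar>"
  show thesis
  proof (rule that[of "B * Suc N + 1"])
    have B: "0 \<le> B" by (simp add: B_def)
    then show K: "0 < B * Suc N + 1" by (simp add: add_nonneg_pos)
    fix x t assume x: "x \<in> ball xbar r" and t: "f x = ereal t" "\<gamma> < t"
    show "infdist x S \<le> e + (B * Suc N + 1) * (t - \<gamma>)"
    proof (cases "infdist x S < e")
      case True
      then show ?thesis using K t(2) by (smt (verit) mult_pos_pos)
    next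
      case False
      then have "x \<in> ?C" using x by auto
      then obtain m where m: "m \<in> D" "\<gamma> + 1 / Suc m < t" using D(2) t(1) by auto
      have "1 / real (Suc N) \<le> 1 / real (Suc m)"
        using N[OF m(1)] by (intro divide_left_mono) auto
      then have "1 / real (Suc N) \<le> t - \<gamma>" using m(2) by linarith
      then have "1 \<le> Suc N * (t - \<gamma>)" by (simp add: field_simps)
      then have "B * 1 \<le> B * (Suc N * (t - \<gamma>))" using B by (intro mult_left_mono)
      moreover have "infdist x S \<le> B"
      proof -
        have "infdist x S \<le> dist x z" by (rule infdist_le[OF z])
        also have "\<dots> \<le> dist xbar x + dist xbar z" by (metis dist_commute dist_triangle)
        also have "\<dots> \<le> B" using x by (simp add: B_def)
        finally show ?thesis .
      qed
      ultimately show ?thesis using e t(2) by (simp add: algebra_simps)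
    qed
  qed
qed

lemma infdist_le_iff:
  fixes S :: "'a::heine_borel set"
  assumes "closed S" "S \<noteq> {}"
  shows "infdist x S \<le> q \<longleftrightarrow> (\<exists>z\<in>S. dist x z \<le> q)"
  using assms infdist_attains_inf[of S x] infdist_le2[of _ S x q] by metis

section \<open>The definable family of affine error bounds\<close>

lemma length_coords [simp]: "length (coords (x :: real ^ 'n)) = CARD('n)"
  by (simp add: coords_def)

lemma dist_coords:
  fixes x y :: "real ^ 'n"
  shows "(dist x y)\<^sup>2 = (\<Sum>i<CARD('n). (coords x ! i - coords y ! i)\<^sup>2)"
proof -
  let ?e = "from_nat_into (UNIV :: 'n set)"
  have e: "bij_betw ?e {..<CARD('n)} UNIV"
    by (rule bij_betw_from_nat_into_finite) simp
  have "(dist x y)\<^sup>2 = (\<Sum>j\<in>UNIV. (x $ j - y $ j)\<^sup>2)"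
    by (simp add: dist_vec_def L2_set_def dist_real_def sum_nonneg)
  also have "\<dots> = (\<Sum>i<CARD('n). (x $ ?e i - y $ ?e i)\<^sup>2)"
    by (rule sum.reindex_bij_betw[OF e, symmetric])
  also have "\<dots> = (\<Sum>i<CARD('n). (coords x ! i - coords y ! i)\<^sup>2)"
    by (intro sum.cong) (auto simp: coords_def)
  finally show ?thesis .
qed

definition error_bounds ::
    "(real ^ 'n \<Rightarrow> ereal) \<Rightarrow> real \<Rightarrow> real ^ 'n \<Rightarrow> real \<Rightarrow> (real \<times> real) set"
  where "error_bounds f \<gamma> xbar r = {(K, c). 0 < K \<and> 0 \<le> c \<and>
    (\<forall>x\<in>ball xbar r. \<forall>t. f x = ereal t \<and> \<gamma> < t \<longrightarrow>
        infdist x {x. f x \<le> ereal \<gamma>} \<le> c + K * (t - \<gamma>))}"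

lemma affine_majorants_error_bounds:
  fixes f :: "real ^ 'n \<Rightarrow> ereal"
  assumes lsc: "lower_semicontinuous f" and ne: "{x. f x \<le> ereal \<gamma>} \<noteq> {}"
  shows "affine_majorants (error_bounds f \<gamma> xbar r)"
proof
  let ?S = "{x. f x \<le> ereal \<gamma>}"
  show "convex (error_bounds f \<gamma> xbar r)"
  proof (rule convexI)
    fix q q' and u v :: real
    assume q: "q \<in> error_bounds f \<gamma> xbar r" "q' \<in> error_bounds f \<gamma> xbar r"
      and uv: "0 \<le> u" "0 \<le> v" "u + v = 1"
    obtain K c L d where [simp]: "q = (K, c)" "q' = (L, d)" by (cases q, cases q')
    have pos: "0 < K" "0 < L" "0 \<le> c" "0 \<le> d"
      using q by (auto simp: error_bounds_def)
    have "0 < u * K + v * L"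
      using pos uv by (metis add.right_neutral add_nonneg_pos add_pos_nonneg less_eq_real_def
          mult_nonneg_nonneg mult_pos_pos mult_zero_left zero_less_one)
    moreover have "infdist x ?S \<le> (u * c + v * d) + (u * K + v * L) * (t - \<gamma>)"
      if "x \<in> ball xbar r" "f x = ereal t" "\<gamma> < t" for x t
    proof -
      have "u * infdist x ?S + v * infdist x ?S
          \<le> u * (c + K * (t - \<gamma>)) + v * (d + L * (t - \<gamma>))"
        using q that uv by (intro add_mono mult_left_mono) (auto simp: error_bounds_def)
      moreover have "u * infdist x ?S + v * infdist x ?S = infdist x ?S"
        by (simp add: uv flip: distrib_right)
      ultimately show ?thesis by (simp add: algebra_simps)
    qed
    ultimately show "u *\<^sub>R q + v *\<^sub>R q' \<in> error_bounds f \<gamma> xbar r"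
      using pos uv by (auto simp: error_bounds_def)
  qed
next
  fix e :: real assume e: "0 < e"
  obtain K where K: "0 < K"
    "\<And>x t. x \<in> ball xbar r \<Longrightarrow> f x = ereal t \<Longrightarrow> \<gamma> < t \<Longrightarrow>
       infdist x {x. f x \<le> ereal \<gamma>} \<le> e / 3 + K * (t - \<gamma>)"
    using affine_error_bound[OF lsc refl ne, of "e / 3" xbar r] e by auto
  \<comment> \<open>Error bounds stay valid when the slope grows, so \<open>1 / L\<close> can be made small as well.\<close>
  define L where "L = max K (3 / e)"
  have L: "K \<le> L" "3 / e \<le> L" by (auto simp: L_def)
  have "infdist x {x. f x \<le> ereal \<gamma>} \<le> e / 3 + L * (t - \<gamma>)"
    if "x \<in> ball xbar r" "f x = ereal t" "\<gamma> < t" for x t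
    using K(2)[OF that] mult_right_mono[OF L(1), of "t - \<gamma>"] that by linarith
  then have "(L, e / 3) \<in> error_bounds f \<gamma> xbar r"
    using K(1) L e by (auto simp: error_bounds_def)
  moreover have "1 / L \<le> e / 3" using L(2) K(1) L(1) e by (simp add: field_simps)
  ultimately show "\<exists>K c. (K, c) \<in> error_bounds f \<gamma> xbar r \<and> c + 1 / K < e"
    using e by (intro exI[of _ L] exI[of _ "e / 3"]) auto
qed (auto simp: error_bounds_def)

text \<open>
  As \<open>S\<close> is closed, the distance to it is attained, so \<open>infdist x S \<le> q\<close> says that some \<open>z\<close> with
  \<open>f z \<le> \<gamma>\<close> has \<open>dist x z \<le> q\<close>, which is a polynomial condition after squaring.  The variables are
  laid out as \<open>[K, c]\<close>, then \<open>x\<close> followed by \<open>f x\<close>, then \<open>z\<close> followed by \<open>f z\<close>.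
\<close>

lemma (in o_minimal_structure) error_bounds_definable:
  fixes f :: "real ^ 'n \<Rightarrow> ereal"
  assumes def: "definable_ereal_fun \<O> f" and finite_below: "\<And>x. f x \<noteq> -\<infinity>" and lsc: "lower_semicontinuous f"
    and ne: "{x. f x \<le> ereal \<gamma>} \<noteq> {}" and r: "0 < r"
  shows "{[K, c] |K c. (K, c) \<in> error_bounds f \<gamma> xbar r} \<in> \<O> 2"
proof -
  let ?N = "CARD('n)"
  let ?S = "{x. f x \<le> ereal \<gamma>}"
  define F where "F = {coords x @ [t] |x t. ereal t = f x}"
  have F: "F \<in> \<O> (?N + 1)" using def by (simp add: definable_ereal_fun_def F_def)
  have "closed ?S"
    using lower_semicontinuous_open[OF lsc, of "ereal \<gamma>"]
    by (simp add: closed_def Compl_eq not_le)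
  note inf_iff = infdist_le_iff[OF this ne]
  define R where "R v z \<longleftrightarrow> z \<in> F \<and> z ! ?N \<le> \<gamma> \<and>
      (\<Sum>i<?N. (v ! (2 + i) - z ! i)\<^sup>2) \<le> (v ! 1 + v ! 0 * (v ! (2 + ?N) - \<gamma>))\<^sup>2" for v z :: "real list"
  define T where "T v w \<longleftrightarrow> (w \<in> F \<and> (\<Sum>i<?N. (coords xbar ! i - w ! i)\<^sup>2) < r\<^sup>2 \<and> \<gamma> < w ! ?N \<longrightarrow>
      (\<exists>z\<in>Rn (?N + 1). R (v @ w) z))" for v w :: "real list"
  have "definable_pred (2 + (?N + 1)) (\<lambda>v. \<exists>z\<in>Rn (?N + 1). R v z)"
  proof (rule definable_ex)
    show "definable_pred (2 + (?N + 1) + (?N + 1)) (\<lambda>v. take (?N + 1) (drop (?N + 3) v) \<in> F \<and>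
        v ! (?N + 3 + ?N) \<le> \<gamma> \<and>
        (\<Sum>i<?N. (v ! (2 + i) - v ! (?N + 3 + i))\<^sup>2) \<le> (v ! 1 + v ! 0 * (v ! (2 + ?N) - \<gamma>))\<^sup>2)"
      by (intro definable_conj definable_block F definable_poly_le polynomial_intros) auto
  qed (auto simp: R_def Rn_def nth_append)
  then have "definable_pred (2 + (?N + 1)) (\<lambda>v. take (?N + 1) (drop 2 v) \<in> F \<and>
      (\<Sum>i<?N. (coords xbar ! i - v ! (2 + i))\<^sup>2) < r\<^sup>2 \<and> \<gamma> < v ! (2 + ?N) \<longrightarrow>
      (\<exists>z\<in>Rn (?N + 1). R v z))"
    by (intro definable_imp definable_conj definable_block F definable_poly_less polynomial_intros) auto
  then have "definable_pred 2 (\<lambda>v. \<forall>w\<in>Rn (?N + 1). T v w)"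
    by (rule definable_all) (auto simp: T_def Rn_def nth_append)
  then have "definable_pred 2 (\<lambda>v. 0 < v ! 0 \<and> 0 \<le> v ! 1 \<and> (\<forall>w\<in>Rn (?N + 1). T v w))"
    by (intro definable_conj definable_poly_less definable_poly_le polynomial_intros) auto
  moreover have "(\<forall>w\<in>Rn (?N + 1). T [K, c] w) \<longleftrightarrow>
      (\<forall>x\<in>ball xbar r. \<forall>t. f x = ereal t \<and> \<gamma> < t \<longrightarrow> infdist x ?S \<le> c + K * (t - \<gamma>))"
    if Kc: "0 < K" "0 \<le> c" for K c
  proof -
    have FR: "F \<subseteq> Rn (?N + 1)" using subsets[OF F] .
    have last: "(coords x @ [t]) ! ?N = t" for x :: "real ^ 'n" and t
      by (simp add: nth_append)
    have sums: "(\<Sum>i<?N. (g i - (coords x @ [t]) ! i)\<^sup>2) = (\<Sum>i<?N. (g i - coords x ! i)\<^sup>2)"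
      for g and x :: "real ^ 'n" and t
      by (intro sum.cong) (auto simp: nth_append)
    have Riff: "(\<exists>z\<in>Rn (?N + 1). R ([K, c] @ coords x @ [t]) z) \<longleftrightarrow> infdist x ?S \<le> c + K * (t - \<gamma>)"
      if "\<gamma> < t" for x t
    proof -
      have q: "0 \<le> c + K * (t - \<gamma>)" using Kc that by simp
      have "(\<exists>z\<in>Rn (?N + 1). R ([K, c] @ coords x @ [t]) z) \<longleftrightarrow>
          (\<exists>z u. ereal u = f z \<and> u \<le> \<gamma> \<and> (dist x z)\<^sup>2 \<le> (c + K * (t - \<gamma>))\<^sup>2)"
      proof -
        have "(\<exists>z\<in>Rn (?N + 1). R ([K, c] @ coords x @ [t]) z) \<longleftrightarrow>
          (\<exists>z u. ereal u = f z \<and> R ([K, c] @ coords x @ [t]) (coords z @ [u]))"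
          using FR by (auto simp: R_def F_def)
        also have "\<dots> \<longleftrightarrow> (\<exists>z u. ereal u = f z \<and> u \<le> \<gamma> \<and> (dist x z)\<^sup>2 \<le> (c + K * (t - \<gamma>))\<^sup>2)"
        proof -
          have "(\<Sum>i<?N. (([K, c] @ coords x @ [t]) ! (2 + i) - (coords z @ [u]) ! i)\<^sup>2) = (dist x z)\<^sup>2"
            for z u
            unfolding dist_coords by (intro sum.cong) (auto simp: nth_append)
          then show ?thesis unfolding R_def F_def by (auto simp: nth_append)
        qed
        finally show ?thesis .
      qed
      also have "\<dots> \<longleftrightarrow> (\<exists>z\<in>?S. dist x z \<le> c + K * (t - \<gamma>))"
      proof -
        have "(\<exists>u. ereal u = f z \<and> u \<le> \<gamma>) \<longleftrightarrow> z \<in> ?S" for z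
          using finite_below[of z] by (cases "f z") auto
        moreover have "(dist x z)\<^sup>2 \<le> (c + K * (t - \<gamma>))\<^sup>2 \<longleftrightarrow> dist x z \<le> c + K * (t - \<gamma>)" for z
          using q by (simp add: power2_le_iff_abs_le)
        ultimately show ?thesis by blast
      qed
      finally show ?thesis using inf_iff by simp
    qed
    have "(\<forall>w\<in>Rn (?N + 1). T [K, c] w) \<longleftrightarrow>
        (\<forall>x t. ereal t = f x \<longrightarrow> T [K, c] (coords x @ [t]))"
      using FR by (auto simp: T_def F_def) blast+
    also have "\<dots> \<longleftrightarrow> (\<forall>x t. ereal t = f x \<longrightarrow> dist xbar x < r \<and> \<gamma> < t \<longrightarrow> infdist x ?S \<le> c + K * (t - \<gamma>))"
    proof -
      have ball: "(dist xbar x)\<^sup>2 < r\<^sup>2 \<longleftrightarrow> dist xbar x < r" for x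
        using r power_mono_iff[of r "dist xbar x" 2] by (simp flip: not_le del: power_mono_iff)
      have "T [K, c] (coords x @ [t]) \<longleftrightarrow>
          (dist xbar x < r \<and> \<gamma> < t \<longrightarrow> infdist x ?S \<le> c + K * (t - \<gamma>))"
        if "ereal t = f x" for x t
      proof -
        have "coords x @ [t] \<in> F" using that by (auto simp: F_def)
        then show ?thesis
          unfolding T_def sums dist_coords[symmetric] last ball using Riff by blast
      qed
      then show ?thesis by blast
    qed
    finally show ?thesis by (auto simp: eq_commute)
  qed
  ultimately have "definable_pred 2 (\<lambda>v. (v ! 0, v ! 1) \<in> error_bounds f \<gamma> xbar r)"
  proof (elim definable_cong)
    fix v assume T_iff: "\<And>K c. 0 < K \<Longrightarrow> 0 \<le> c \<Longrightarrow> (\<forall>w\<in>Rn (?N + 1). T [K, c] w) \<longleftrightarrow>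
      (\<forall>x\<in>ball xbar r. \<forall>t. f x = ereal t \<and> \<gamma> < t \<longrightarrow> infdist x ?S \<le> c + K * (t - \<gamma>))"
    assume "v \<in> Rn 2"
    then obtain K c where v: "v = [K, c]"
      by (auto simp: Rn_def numeral_2_eq_2 length_Suc_conv)
    show "(0 < v ! 0 \<and> 0 \<le> v ! 1 \<and> (\<forall>w\<in>Rn (?N + 1). T v w)) \<longleftrightarrow>
        (v ! 0, v ! 1) \<in> error_bounds f \<gamma> xbar r"
      using T_iff[of K c] unfolding v error_bounds_def by auto
  qed
  moreover have "{v \<in> Rn 2. (v ! 0, v ! 1) \<in> error_bounds f \<gamma> xbar r}
      = {[K, c] |K c. (K, c) \<in> error_bounds f \<gamma> xbar r}"
    by (auto simp: Rn_def numeral_2_eq_2 length_Suc_conv)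
  ultimately show ?thesis by (simp add: definable_pred_def)
qed

theorem theorem3p5:
  fixes \<O> :: "nat \<Rightarrow> real list set set"
    and f :: "real ^ 'n \<Rightarrow> ereal"
    and \<gamma> :: real
    and S :: "(real ^ 'n) set"
  assumes "o_minimal_structure \<O>"
    and "proper_fun f"
    and "lower_semicontinuous f"
    and "definable_ereal_fun \<O> f"
    and "S = {x. f x \<le> ereal \<gamma>}"
    and "S \<noteq> {}"
  shows "\<forall>(xbar :: real ^ 'n) (r :: real). r > 0 \<longrightarrow>
    (\<exists>\<phi> :: real \<Rightarrow> real.
      strict_mono_on {0..} \<phi> \<and>
      definable_real_fun_on \<O> {0..} \<phi> \<and>
      concave_on {0..} \<phi> \<and>
      continuous_on {0..} \<phi> \<and>
      \<phi> C1_differentiable_on {0<..} \<and>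
      \<phi> 0 = 0 \<and>
      (\<forall>x \<in> ball xbar r \<inter> edom f.
         infdist x S \<le> \<phi> (max (real_of_ereal (f x) - \<gamma>) 0)))"
proof (intro allI impI)
  fix xbar :: "real ^ 'n" and r :: real
  assume r: "0 < r"
  let ?Q = "error_bounds f \<gamma> xbar r"
  have ne: "{x. f x \<le> ereal \<gamma>} \<noteq> {}" using assms by simp
  interpret affine_majorants ?Q
    using affine_majorants_error_bounds[OF assms(3) ne] .
  have "{[K, c] |K c. (K, c) \<in> ?Q} \<in> \<O> 2"
    by (rule o_minimal_structure.error_bounds_definable[OF assms(1,4) _ assms(3) ne r])
      (use assms(2) in \<open>simp add: proper_fun_def\<close>)
  then have definable: "definable_real_fun_on \<O> {0..} envelope"
    by (rule o_minimal_structure.envelope_definable[OF assms(1) affine_majorants_axioms])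
  have bound: "infdist x S \<le> envelope (max (real_of_ereal (f x) - \<gamma>) 0)"
    if x: "x \<in> ball xbar r \<inter> edom f" for x
  proof (cases "f x \<le> ereal \<gamma>")
    case True
    then have "infdist x S = 0" using assms(5) by simp
    then show ?thesis using envelope_nonneg by simp
  next
    case False
    then obtain t where t: "f x = ereal t" "\<gamma> < t"
      using x by (cases "f x") (auto simp: edom_def)
    have "infdist x S \<le> envelope (t - \<gamma>)"
    proof (rule envelope_greatest)
      fix K c assume Kc: "(K, c) \<in> ?Q"
      then have "infdist x S \<le> c + K * (t - \<gamma>)"
        using x t assms(5) by (auto simp: error_bounds_def)
      then show "infdist x S \<le> c + 1 / K + K * (t - \<gamma>)"
        using slope_pos[OF Kc] by (smt (verit) divide_pos_pos)
    qed
    then show ?thesis using t by simp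
  qed
  show "\<exists>\<phi> :: real \<Rightarrow> real.
      strict_mono_on {0..} \<phi> \<and>
      definable_real_fun_on \<O> {0..} \<phi> \<and>
      concave_on {0..} \<phi> \<and>
      continuous_on {0..} \<phi> \<and>
      \<phi> C1_differentiable_on {0<..} \<and>
      \<phi> 0 = 0 \<and>
      (\<forall>x \<in> ball xbar r \<inter> edom f.
         infdist x S \<le> \<phi> (max (real_of_ereal (f x) - \<gamma>) 0))"
    using envelope_strict_mono definable envelope_concave envelope_continuous envelope_C1
      envelope_0 bound by blast
qed

end
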